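(* For every integer $d\ge 2$, the $d$-dimensional hypercube $Q_d$ satisfies $\chi_{\rm pcf}(Q_d)=4$.
   Context: All graphs are simple, finite and undirected. A vertex coloring of a graph is proper if adjacent vertices get distinct colors. It is conflict-free (with respect to open neighborhoods) if for every non-isolated vertex $x$ there is a color that appears exactly once on the open neighborhood $N(x)$. A PCF $k$-coloring is a vertex coloring with at most $k$ colors that is both proper and conflict-free. The PCF chromatic number $\chi_{\rm pcf}(G)$ is the minimum $k$ for which $G$ admits a PCF $k$-coloring. *)

theory Defs
  imports "Graph_Theory.Pair_Digraph" "HOL-Library.FuncSet"
begin

text \<open>
  Simple finite undirected graphs are symmetric loop-free digraphs (locale \<^locale>\<open>pair_graph\<close>):
  an undirected edge between \<open>u\<close> and \<open>v\<close> is the pair of arcs \<open>(u, v)\<close> and \<open>(v, u)\<close>.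
\<close>

definition open_nbhd :: "'a pair_pre_digraph \<Rightarrow> 'a \<Rightarrow> 'a set" where
  "open_nbhd G x = {y \<in> pverts G. (x, y) \<in> parcs G}"

definition proper_coloring :: "'a pair_pre_digraph \<Rightarrow> ('a \<Rightarrow> 'c) \<Rightarrow> bool" where
  "proper_coloring G c \<longleftrightarrow> (\<forall>x \<in> pverts G. \<forall>y \<in> open_nbhd G x. c x \<noteq> c y)"

definition conflict_free_coloring :: "'a pair_pre_digraph \<Rightarrow> ('a \<Rightarrow> 'c) \<Rightarrow> bool" where
  "conflict_free_coloring G c \<longleftrightarrow>
     (\<forall>x \<in> pverts G. open_nbhd G x \<noteq> {} \<longrightarrow> (\<exists>a. \<exists>!y. y \<in> open_nbhd G x \<and> c y = a))"

text \<open>The colors are \<open>0, \<dots>, k - 1\<close>; they need not all be used.\<close>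

definition pcf_coloring :: "'a pair_pre_digraph \<Rightarrow> nat \<Rightarrow> ('a \<Rightarrow> nat) \<Rightarrow> bool" where
  "pcf_coloring G k c \<longleftrightarrow>
     c \<in> pverts G \<rightarrow> {..<k} \<and> proper_coloring G c \<and> conflict_free_coloring G c"

definition pcf_chromatic_number :: "'a pair_pre_digraph \<Rightarrow> nat" where
  "pcf_chromatic_number G = (LEAST k. \<exists>c. pcf_coloring G k c)"

text \<open>The minimum is attained for every graph, since coloring all vertices differently works.\<close>

lemma (in pair_graph) ex_pcf_coloring: "\<exists>k c. pcf_coloring G k c"
proof -
  obtain n :: nat and c where c: "c ` pverts G = {i. i < n}" "inj_on c (pverts G)"
    using finite_imp_inj_to_nat_seg[OF pair_finite_verts] by blast
  have "conflict_free_coloring G c"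
    unfolding conflict_free_coloring_def
  proof (intro ballI impI)
    fix x assume "open_nbhd G x \<noteq> {}"
    then obtain y where y: "y \<in> open_nbhd G x" by blast
    have "open_nbhd G x \<subseteq> pverts G" by (auto simp: open_nbhd_def)
    then have "\<exists>!z. z \<in> open_nbhd G x \<and> c z = c y"
      using y inj_onD[OF c(2)] by blast
    then show "\<exists>a. \<exists>!z. z \<in> open_nbhd G x \<and> c z = a" by blast
  qed
  moreover have "proper_coloring G c"
    unfolding proper_coloring_def
  proof (intro ballI)
    fix x y assume "x \<in> pverts G" "y \<in> open_nbhd G x"
    then have "y \<in> pverts G" "x \<noteq> y"
      using pair_no_loops[of "(x, y)"] by (auto simp: open_nbhd_def)
    with \<open>x \<in> pverts G\<close> show "c x \<noteq> c y"
      using inj_onD[OF c(2)] by blast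
  qed
  moreover have "c \<in> pverts G \<rightarrow> {..<n}"
    using c(1) by auto
  ultimately show ?thesis unfolding pcf_coloring_def by blast
qed

definition hypercube :: "nat \<Rightarrow> bool list pair_pre_digraph" where
  "hypercube d =
     \<lparr> pverts = {xs. length xs = d},
       parcs = {(xs, ys). length xs = d \<and> length ys = d \<and>
                          card {i. i < d \<and> xs ! i \<noteq> ys ! i} = 1} \<rparr>"

lemma pair_graph_hypercube: "pair_graph (hypercube d)"
proof -
  have fin: "finite {xs :: bool list. length xs = d}"
    using finite_lists_length_eq[of "UNIV :: bool set" d] by simp
  have arc_iff: "(xs, ys) \<in> parcs (hypercube d) \<longleftrightarrow>
      length xs = d \<and> length ys = d \<and> card {i. i < d \<and> xs ! i \<noteq> ys ! i} = 1" for xs ys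
    unfolding hypercube_def by simp
  have verts: "pverts (hypercube d) = {xs. length xs = d}"
    unfolding hypercube_def by simp
  have arcs_sub: "parcs (hypercube d) \<subseteq> {xs. length xs = d} \<times> {xs. length xs = d}"
    unfolding hypercube_def by auto
  have sym: "sym (parcs (hypercube d))"
  proof (rule symI)
    fix xs ys assume "(xs, ys) \<in> parcs (hypercube d)"
    moreover have "{i. i < d \<and> ys ! i \<noteq> xs ! i} = {i. i < d \<and> xs ! i \<noteq> ys ! i}"
      by blast
    ultimately show "(ys, xs) \<in> parcs (hypercube d)"
      unfolding arc_iff by metis
  qed
  have irrefl: "(xs, xs) \<notin> parcs (hypercube d)" for xs
    unfolding arc_iff by simp
  show ?thesis
  proof unfold_locales
    fix e assume e: "e \<in> parcs (hypercube d)"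
    show "fst e \<in> pverts (hypercube d)" "snd e \<in> pverts (hypercube d)"
      using e arcs_sub unfolding verts by auto
    show "fst e \<noteq> snd e"
      using e irrefl by (metis prod.collapse)
  next
    show "finite (pverts (hypercube d))"
      unfolding verts by (rule fin)
    show "finite (parcs (hypercube d))"
      by (rule finite_subset[OF arcs_sub finite_cartesian_product[OF fin fin]])
    show "symmetric (with_proj (hypercube d))"
      unfolding symmetric_def with_proj_simps by (rule sym)
  qed
qed

end

theory Submission
  imports Defs
begin

text \<open>
  Lower bound: in a PCF coloring with three colors, let \<open>y\<close> be a neighbor of \<open>x\<close> whose color is
  unique on \<open>N(x)\<close>. Every neighbor \<open>w \<noteq> x\<close> of \<open>y\<close> lies on a 4-cycle \<open>x, y, w, z\<close>, where \<open>z\<close> has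
  the third color because \<open>y\<close> is unique, so \<open>w\<close> has the color of \<open>x\<close>. Hence \<open>N(y)\<close> is monochromatic,
  although it has at least two elements.

  Upper bound: identify the colors with the elements of the Klein four-group \<open>{0, u, v, u + v}\<close> and
  color \<open>x\<close> by \<open>x\<^sub>0 u + (x\<^sub>1 + \<dots> + x\<^bsub>d-1\<^esub>) v\<close>. Flipping the first coordinate of \<open>x\<close> adds \<open>u\<close> to
  its color, and flipping any other adds \<open>v\<close>, so the former color is unique on \<open>N(x)\<close>.
\<close>

definition flip :: "nat \<Rightarrow> bool list \<Rightarrow> bool list" where
  "flip i xs = xs[i := \<not> xs ! i]"

lemma length_flip [simp]: "length (flip i xs) = length xs"
  by (simp add: flip_def)

lemma flip_flip [simp]: "flip i (flip i xs) = xs"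
  by (cases "i < length xs") (simp_all add: flip_def list_update_beyond)

lemma flip_commute: "flip i (flip j xs) = flip j (flip i xs)"
  by (cases "i = j") (simp_all add: flip_def list_update_swap)

text \<open>Entry \<open>i\<close> tells the two lists apart, since only a flip at \<open>i\<close>
  changes it. Thus distinct coordinates give distinct neighbors.\<close>

lemma flip_eq_iff: "i < length xs \<Longrightarrow> flip i xs = flip j xs \<longleftrightarrow> i = j"
  by (metis flip_def nth_list_update_eq nth_list_update_neq)

lemma flip_Cons_0 [simp]: "flip 0 (b # xs) = (\<not> b) # xs"
  by (simp add: flip_def)

lemma flip_Cons_Suc [simp]: "flip (Suc i) (b # xs) = b # flip i xs"
  by (simp add: flip_def)

lemma pverts_hypercube [simp]: "pverts (hypercube d) = {xs. length xs = d}"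
  by (simp add: hypercube_def)

lemma open_nbhd_hypercube:
  assumes "length xs = d"
  shows "open_nbhd (hypercube d) xs = (\<lambda>i. flip i xs) ` {..<d}"
proof (intro equalityI subsetI)
  fix ys assume "ys \<in> open_nbhd (hypercube d) xs"
  then have len: "length ys = d" and "card {i. i < d \<and> xs ! i \<noteq> ys ! i} = 1"
    by (auto simp: open_nbhd_def hypercube_def)
  then obtain i where i: "{i. i < d \<and> xs ! i \<noteq> ys ! i} = {i}"
    by (auto simp: card_1_singleton_iff)
  \<comment> \<open>Entries are Boolean, so differing from \<open>xs\<close> at \<open>i\<close>
    means being the negation there.\<close>
  have "ys = flip i xs"
  proof (rule nth_equalityI)
    fix j assume "j < length ys"
    then show "ys ! j = flip i xs ! j"
      using i len assms by (cases "j = i") (auto simp: flip_def)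
  qed (use len assms in simp)
  then show "ys \<in> (\<lambda>i. flip i xs) ` {..<d}"
    using i by blast
next
  fix ys assume "ys \<in> (\<lambda>i. flip i xs) ` {..<d}"
  then obtain i where i: "i < d" "ys = flip i xs" by auto
  then have "{j. j < d \<and> xs ! j \<noteq> ys ! j} = {i}"
    using assms by (auto simp: flip_def nth_list_update split: if_splits)
  then show "ys \<in> open_nbhd (hypercube d) xs"
    using i assms by (simp add: open_nbhd_def hypercube_def)
qed

lemma proper_coloring_hypercube_iff:
  "proper_coloring (hypercube d) c \<longleftrightarrow>
    (\<forall>xs i. length xs = d \<longrightarrow> i < d \<longrightarrow> c (flip i xs) \<noteq> c xs)"
proof -
  have "(\<forall>ys \<in> open_nbhd (hypercube d) xs. c xs \<noteq> c ys) \<longleftrightarrow> (\<forall>i<d. c (flip i xs) \<noteq> c xs)"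
    if "length xs = d" for xs
    unfolding open_nbhd_hypercube[OF that] by (auto simp: eq_commute)
  then show ?thesis
    by (simp add: proper_coloring_def)
qed

text \<open>Neighbors correspond one-to-one to coordinates, and \<open>d > 0\<close> makes every
  vertex non-isolated, so the condition can be stated with indices alone.\<close>

lemma conflict_free_coloring_hypercube_iff:
  assumes "d > 0"
  shows "conflict_free_coloring (hypercube d) c \<longleftrightarrow>
    (\<forall>xs. length xs = d \<longrightarrow>
      (\<exists>i<d. \<forall>j<d. j \<noteq> i \<longrightarrow> c (flip j xs) \<noteq> c (flip i xs)))"
proof -
  have "(\<exists>a. \<exists>!y. y \<in> open_nbhd (hypercube d) xs \<and> c y = a) \<longleftrightarrow>
      (\<exists>i<d. \<forall>j<d. j \<noteq> i \<longrightarrow> c (flip j xs) \<noteq> c (flip i xs))"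
    if len: "length xs = d" for xs
  proof
    assume "\<exists>a. \<exists>!y. y \<in> open_nbhd (hypercube d) xs \<and> c y = a"
    then obtain i where "i < d" "\<forall>j<d. c (flip j xs) = c (flip i xs) \<longrightarrow> flip j xs = flip i xs"
      unfolding open_nbhd_hypercube[OF len] by blast
    then show "\<exists>i<d. \<forall>j<d. j \<noteq> i \<longrightarrow> c (flip j xs) \<noteq> c (flip i xs)"
      using len flip_eq_iff by metis
  next
    assume "\<exists>i<d. \<forall>j<d. j \<noteq> i \<longrightarrow> c (flip j xs) \<noteq> c (flip i xs)"
    then show "\<exists>a. \<exists>!y. y \<in> open_nbhd (hypercube d) xs \<and> c y = a"
      unfolding open_nbhd_hypercube[OF len] by blast
  qed
  then show ?thesis
    using assms by (simp add: conflict_free_coloring_def open_nbhd_hypercube lessThan_empty_iff)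
qed

lemma pcf_coloring_hypercube_ge_4:
  assumes "d \<ge> 2" and "pcf_coloring (hypercube d) k c"
  shows "k \<ge> 4"
proof (rule ccontr)
  assume "\<not> k \<ge> 4"
  have range: "c xs < 3" if "length xs = d" for xs
  proof -
    have "c xs < k"
      using assms(2) that by (simp add: pcf_coloring_def Pi_iff)
    with \<open>\<not> k \<ge> 4\<close> show ?thesis by simp
  qed
  have proper: "c (flip i xs) \<noteq> c xs" if "length xs = d" "i < d" for i xs
    using assms(2) that by (simp add: pcf_coloring_def proper_coloring_hypercube_iff)
  have unique: "\<exists>i<d. \<forall>j<d. j \<noteq> i \<longrightarrow> c (flip j xs) \<noteq> c (flip i xs)" if "length xs = d" for xs
    using assms that by (simp add: pcf_coloring_def conflict_free_coloring_hypercube_iff)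
  \<comment> \<open>An arbitrary vertex; only its length matters.\<close>
  define x where "x = replicate d False"
  have x: "length x = d" by (simp add: x_def)
  obtain i where i: "i < d" and i_unique: "\<And>j. j < d \<Longrightarrow> j \<noteq> i \<Longrightarrow> c (flip j x) \<noteq> c (flip i x)"
    using unique[OF x] by blast
  define y where "y = flip i x"
  have y: "length y = d" by (simp add: y_def x)
  have mono: "c (flip j y) = c x" if j: "j < d" for j
  proof (cases "j = i")
    case False
    define z where "z = flip j x"
    have z: "length z = d" by (simp add: z_def x)
    \<comment> \<open>Commuting flips close the 4-cycle: \<open>flip j y\<close> is adjacent to both
      \<open>y\<close> and \<open>z\<close>.\<close>
    have "flip j y = flip i z"
      by (simp add: y_def z_def flip_commute)
    then have "c (flip j y) \<noteq> c y" "c (flip j y) \<noteq> c z"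
      using proper[OF y j] proper[OF z i] by simp_all
    moreover have "c z \<noteq> c y" "c z \<noteq> c x" "c y \<noteq> c x"
      using i_unique[OF j False] proper[OF x j] proper[OF x i] by (simp_all add: y_def z_def)
    \<comment> \<open>\<open>x\<close>, \<open>y\<close>, \<open>z\<close> use up all three colors,
      and \<open>flip j y\<close> avoids those of \<open>y\<close> and \<open>z\<close>.\<close>
    ultimately show ?thesis
      using range[OF x] range[OF y] range[OF z] range[of "flip j y"] y by simp
  qed (simp add: y_def)
  obtain l where l: "l < d" "\<And>j. j < d \<Longrightarrow> j \<noteq> l \<Longrightarrow> c (flip j y) \<noteq> c (flip l y)"
    using unique[OF y] by blast
  \<comment> \<open>As \<open>d \<ge> 2\<close>, one of the coordinates 0 and 1 differs from
    \<open>l\<close>.\<close>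
  obtain j where "j < d" "j \<noteq> l"
    using assms(1) that[of 0] that[of 1] by fastforce
  then show False
    using l mono by metis
qed

text \<open>The group element a u + b v, with bits a and b, is encoded as the number a + 2b.\<close>

definition hypercube_coloring :: "bool list \<Rightarrow> nat" where
  "hypercube_coloring xs = of_bool (hd xs) + 2 * of_bool (odd (count_list (tl xs) True))"

lemma odd_count_list_flip:
  "i < length xs \<Longrightarrow> odd (count_list (flip i xs) True) \<longleftrightarrow> even (count_list xs True)"
proof (induction xs arbitrary: i)
  case (Cons b xs)
  then show ?case by (cases i) auto
qed simp

lemma pcf_coloring_hypercube:
  assumes "d > 0"
  shows "pcf_coloring (hypercube d) 4 hypercube_coloring"
proof -
  \<comment> \<open>A flip at 0 toggles the low bit of the color, any other flip the high
    bit.\<close>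
  have flip_0: "hypercube_coloring (flip 0 xs) =
        of_bool (\<not> hd xs) + 2 * of_bool (odd (count_list (tl xs) True))"
    and flip_pos: "i \<noteq> 0 \<Longrightarrow> i < d \<Longrightarrow> hypercube_coloring (flip i xs) =
        of_bool (hd xs) + 2 * of_bool (even (count_list (tl xs) True))"
    if "length xs = d" for xs i
    using that assms
    by (cases xs; cases i; auto simp: hypercube_coloring_def odd_count_list_flip)+
  have "hypercube_coloring (flip i xs) \<noteq> hypercube_coloring xs"
    if "length xs = d" "i < d" for xs i
    using that flip_0[of xs] flip_pos[of xs i]
    by (cases "i = 0") (auto simp: hypercube_coloring_def)
  \<comment> \<open>Coordinate 0 is the witness for conflict-freeness at every vertex.\<close>
  moreover have "\<forall>j<d. j \<noteq> 0 \<longrightarrow>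
      hypercube_coloring (flip j xs) \<noteq> hypercube_coloring (flip 0 xs)"
    if "length xs = d" for xs
    using that by (auto simp: flip_0 flip_pos)
  moreover have "hypercube_coloring xs < 4" for xs
    by (simp add: hypercube_coloring_def)
  ultimately show ?thesis
    using assms unfolding pcf_coloring_def proper_coloring_hypercube_iff
      conflict_free_coloring_hypercube_iff[OF assms] by blast
qed

theorem mainTheorem2:
  fixes d :: nat
  assumes "d \<ge> 2"
  shows "pcf_chromatic_number (hypercube d) = 4"
  unfolding pcf_chromatic_number_def
proof (rule Least_equality)
  show "\<exists>c. pcf_coloring (hypercube d) 4 c"
    using assms pcf_coloring_hypercube[of d] by auto
qed (use assms pcf_coloring_hypercube_ge_4 in blast)

end
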